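(* Let $m,q\geq 2$ and let $a,b$ be positive integers. There is a one-to-one correspondence between the set of all conjugate $(m^a,q^b)$-ary partitions and the set of conjugate $(m,q)$-ary partitions of the form $M^{as_k}R^{bt_k}\cdots M^{as_1}R^{bt_1}(1)_m$ (with $k\geq 1$ and non-negative integers $s_i,t_i$).
   Context: Let $m,q\ge 2$ be integers. A partition $\lambda$ of a positive integer $n$ is $m$-ary if all its parts are powers $m^i$, $i\ge 0$ (so $m^0=1$ is allowed). If $a_i$ is the number of times the part $m^i$ appears in $\lambda$, one writes $\lambda=(a_k,a_{k-1},\ldots,a_0)_m$, where $a_k\neq 0$ and $a_i=0$ for $i>k$. $\lambda$ is conjugate $(m,q)$-ary if $\lambda$ is $m$-ary and its conjugate $\lambda'$ is $q$-ary; equivalently, $\lambda$ is $m$-ary and each partial sum $\sum_{i=r}^k a_i$, $0\le r\le k$, is a power of $q$ (with $q^0=1$ allowed). For a conjugate $(m,q)$-ary partition $\lambda=(a_k,\ldots,a_0)_m$, define the operators (each producing a conjugate $(m,q)$-ary partition): raise $R(\lambda)=(qa_k,\ldots,qa_0)_m$ and migration $M(\lambda)=(1,a_k-1,a_{k-1},\ldots,a_0)_m$. Sequences of operators are composed as functions (rightmost applied first), and $(1)_m$ is the trivial partition of $1$. *)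

theory Defs
  imports Main "HOL-Library.Multiset"
begin

text \<open>Partitions are represented as multisets of their parts.\<close>

definition partition_of :: "nat \<Rightarrow> nat multiset \<Rightarrow> bool" where
  "partition_of n P \<longleftrightarrow> 0 \<notin># P \<and> sum_mset P = n"

text \<open>The \<open>j\<close>-th part of the conjugate is the number of parts that are at least \<open>j\<close>,
  where \<open>j\<close> runs from 1 to the largest part.\<close>

definition conjugate :: "nat multiset \<Rightarrow> nat multiset" where
  "conjugate P = image_mset (\<lambda>j. size {#p \<in># P. j \<le> p#}) (mset_set {1..Max (set_mset P)})"

definition ary :: "nat \<Rightarrow> nat multiset \<Rightarrow> bool" where
  "ary m P \<longleftrightarrow> (\<exists>n>0. partition_of n P) \<and> (\<forall>p\<in>#P. \<exists>i. p = m ^ i)"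

definition conj_ary :: "nat \<Rightarrow> nat \<Rightarrow> nat multiset \<Rightarrow> bool" where
  "conj_ary m q P \<longleftrightarrow> ary m P \<and> ary q (conjugate P)"

text \<open>\<open>of_digits m [a\<^sub>k, \<dots>, a\<^sub>0]\<close> is the partition $(a_k,\ldots,a_0)_m$, and \<open>digits m P\<close>
  recovers the list \<open>[a\<^sub>k, \<dots>, a\<^sub>0]\<close> with \<open>a\<^sub>k \<noteq> 0\<close> from an \<open>m\<close>-ary \<open>P\<close>.\<close>

fun of_digits :: "nat \<Rightarrow> nat list \<Rightarrow> nat multiset" where
  "of_digits m [] = {#}"
| "of_digits m (a # as) = replicate_mset a (m ^ length as) + of_digits m as"

definition digits :: "nat \<Rightarrow> nat multiset \<Rightarrow> nat list" where
  "digits m P = map (\<lambda>i. count P (m ^ i)) (rev [0..<Suc (Max {i. m ^ i \<in># P})])"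

definition raise :: "nat \<Rightarrow> nat \<Rightarrow> nat multiset \<Rightarrow> nat multiset" where
  "raise m q P = of_digits m (map (\<lambda>a. q * a) (digits m P))"

definition migration :: "nat \<Rightarrow> nat multiset \<Rightarrow> nat multiset" where
  "migration m P = of_digits m (1 # (hd (digits m P) - 1) # tl (digits m P))"

text \<open>\<open>MR_word m q [(s\<^sub>k, t\<^sub>k), \<dots>, (s\<^sub>1, t\<^sub>1)]\<close> is
  $M^{s_k} R^{t_k} \cdots M^{s_1} R^{t_1} (1)_m$.\<close>

fun MR_word :: "nat \<Rightarrow> nat \<Rightarrow> (nat \<times> nat) list \<Rightarrow> nat multiset" where
  "MR_word m q [] = of_digits m [1]"
| "MR_word m q ((s, t) # w) = (migration m ^^ s) ((raise m q ^^ t) (MR_word m q w))"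

lemma count_of_digits:
  assumes "2 \<le> m"
  shows "count (of_digits m as) (m ^ i) = (if i < length as then rev as ! i else 0)"
  using assms by (induction as) (auto simp: nth_append)

lemma digits_of_digits:
  assumes m: "2 \<le> m" and a: "a \<noteq> 0"
  shows "digits m (of_digits m (a # as)) = a # as"
proof -
  let ?P = "of_digits m (a # as)"
  have c: "count ?P (m ^ i) = (if i < length (a # as) then rev (a # as) ! i else 0)" for i
    by (rule count_of_digits[OF m])
  have *: "m ^ i \<in># ?P \<Longrightarrow> i \<le> length as" for i
  proof -
    assume "m ^ i \<in># ?P"
    then have "count ?P (m ^ i) \<noteq> 0" by (simp only: count_eq_zero_iff not_not)
    then show "i \<le> length as" unfolding c by (simp split: if_splits)
  qed
  have "Max {i. m ^ i \<in># ?P} = length as"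
  proof (rule Max_eqI)
    have "{i. m ^ i \<in># ?P} \<subseteq> {..length as}"
      using * by blast
    then show "finite {i. m ^ i \<in># ?P}"
      by (rule finite_subset) simp
    show "i \<le> length as" if "i \<in> {i. m ^ i \<in># ?P}" for i
      using * that by blast
    show "length as \<in> {i. m ^ i \<in># ?P}"
      using a by simp
  qed
  then have "digits m ?P = rev (map (\<lambda>i. count ?P (m ^ i)) [0..<length (rev (a # as))])"
    by (simp add: digits_def rev_map)
  also have "map (\<lambda>i. count ?P (m ^ i)) [0..<length (rev (a # as))] = rev (a # as)"
    by (rule nth_equalityI) (simp_all only: c length_map length_upt diff_zero nth_map_upt
      length_rev add_0 if_True)
  finally show ?thesis by simp
qed

lemma raise_of_digits:
  "2 \<le> m \<Longrightarrow> a \<noteq> 0 \<Longrightarrow>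
    raise m q (of_digits m (a # as)) = of_digits m (map (\<lambda>a. q * a) (a # as))"
  using digits_of_digits[of m a as] by (simp add: raise_def del: of_digits.simps)

lemma migration_of_digits:
  "2 \<le> m \<Longrightarrow> a \<noteq> 0 \<Longrightarrow>
    migration m (of_digits m (a # as)) = of_digits m (1 # (a - 1) # as)"
  using digits_of_digits[of m a as] by (simp add: migration_def del: of_digits.simps)

lemma of_digits_digits:
  assumes m: "2 \<le> m" and P: "ary m P"
  shows "of_digits m (digits m P) = P" and "digits m P \<noteq> []" and "hd (digits m P) \<noteq> 0"
proof -
  let ?k = "Max {i. m ^ i \<in># P}"
  have inj: "inj (\<lambda>i. m ^ i)" using m by (auto intro!: injI)
  have fin: "finite {i. m ^ i \<in># P}"
    using finite_vimageI[OF finite_set_mset inj, of P] by (simp add: vimage_def)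
  have "P \<noteq> {#}" using P by (auto simp: ary_def partition_of_def)
  then obtain p where p: "p \<in># P" by (rule multiset_nonemptyE)
  then obtain i where "p = m ^ i" using P unfolding ary_def by blast
  with p have ne: "{i. m ^ i \<in># P} \<noteq> {}" by blast
  have k: "m ^ ?k \<in># P" using Max_in[OF fin ne] by simp
  show "digits m P \<noteq> []" by (simp add: digits_def)
  show "hd (digits m P) \<noteq> 0" using k by (simp add: digits_def)
  have pw: "set_mset (of_digits m as) \<subseteq> range (\<lambda>i. m ^ i)" for as
    by (induction as) (auto split: if_splits)
  show "of_digits m (digits m P) = P"
  proof (rule multiset_eqI)
    fix x
    show "count (of_digits m (digits m P)) x = count P x"
    proof (cases "\<exists>i. x = m ^ i")
      case True
      then obtain i where i: "x = m ^ i" by blast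
      have le: "i \<le> ?k" if "m ^ i \<in># P" by (rule Max_ge[OF fin]) (use that in simp)
      have "count P (m ^ i) = 0" if "\<not> i < Suc ?k"
        unfolding count_eq_zero_iff
      proof
        assume "m ^ i \<in># P"
        from le[OF this] that show False by linarith
      qed
      moreover have "rev (digits m P) ! i = count P (m ^ i)" if "i < Suc ?k"
        using that by (simp only: digits_def rev_map[symmetric] rev_rev_ident)
          (simp del: upt_Suc)
      moreover have "length (digits m P) = Suc ?k" by (simp add: digits_def)
      ultimately show ?thesis unfolding i count_of_digits[OF m] by auto
    next
      case False
      have "x \<notin># P" using P False unfolding ary_def by blast
      moreover have "x \<notin># of_digits m (digits m P)"
        using pw[of "digits m P"] False by blast
      ultimately show ?thesis by (simp add: not_in_iff)
    qed
  qed
qed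

end

theory Submission
  imports Defs
begin

text \<open>A conjugate \<open>(m, q)\<close>-ary partition \<open>(a\<^sub>k, \<dots>, a\<^sub>0)\<^sub>m\<close> is the same thing as a nonempty
  weakly increasing list \<open>[c\<^sub>k, \<dots>, c\<^sub>0]\<close> of natural numbers, namely the exponents of its partial
  sums \<open>a\<^sub>k + \<dots> + a\<^sub>r = q ^ c\<^sub>r\<close>. This description does not involve the values of \<open>m\<close> and \<open>q\<close>,
  and it makes the operators transparent: raise adds 1 to every exponent, and migration puts a new
  exponent 0 in front.

  In these coordinates a word and the word with all \<open>s\<close> multiplied by \<open>a\<close> and all \<open>t\<close> by \<open>b\<close>
  differ by an explicit map of lists (\<open>exponents_scaled_word\<close>): every exponent is multiplied by
  \<open>b\<close>, and every exponent is repeated \<open>a\<close> times except the last, which comes from the starting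
  partition \<open>(1)\<^sub>m\<close> and not from a migration. This map is injective, and every
  nonempty increasing list is the exponent list of a word (\<open>sorted_is_exponents\<close>). Transporting it
  through the two codings \<open>(m ^ a, q ^ b)\<close> and \<open>(m, q)\<close> yields the bijection. Different words, for instance with
  zero entries, may produce the same partition, but a partition has only one exponent list
  (\<open>inj_on_exp_partition\<close>); hence the prescription on words is well defined.\<close>

section \<open>Partitions with prescribed partial sums\<close>

text \<open>The digits after a prefix with sum \<open>p\<close> whose further partial sums are \<open>q ^ c\<close>
  for \<open>c\<close> in the list. The subtractions are exact when the list is increasing and
  \<open>p \<le> q ^ c\<close> holds for its members. Keeping \<open>p\<close> as a parameter lets inductions run from the
  leading digit.\<close>

fun power_diffs :: "nat \<Rightarrow> nat \<Rightarrow> nat list \<Rightarrow> nat list" where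
  "power_diffs q p [] = []"
| "power_diffs q p (c # cs) = (q ^ c - p) # power_diffs q (q ^ c) cs"

definition exp_partition :: "nat \<Rightarrow> nat \<Rightarrow> nat list \<Rightarrow> nat multiset" where
  "exp_partition m q cs = of_digits m (power_diffs q 0 cs)"

definition exp_lists :: "nat list set" where
  "exp_lists = {cs. cs \<noteq> [] \<and> sorted cs}"

lemma length_power_diffs [simp]: "length (power_diffs q p cs) = length cs"
  by (induction cs arbitrary: p) auto

lemma sum_list_take_power_diffs:
  assumes "2 \<le> q" "sorted cs" "\<forall>c\<in>set cs. p \<le> q ^ c" "i < length cs"
  shows "p + sum_list (take (Suc i) (power_diffs q p cs)) = q ^ (cs ! i)"
  using assms
proof (induction cs arbitrary: p i)
  case (Cons c cs)
  show ?case
  proof (cases i)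
    case 0
    with Cons.prems show ?thesis by simp
  next
    case (Suc j)
    have "q ^ c + sum_list (take (Suc j) (power_diffs q (q ^ c) cs)) = q ^ (cs ! j)"
      using Cons.prems Suc by (intro Cons.IH) auto
    with Cons.prems Suc show ?thesis by simp
  qed
qed simp

lemma power_diffs_of_partial_sums:
  assumes "2 \<le> q" "\<forall>i<length as. \<exists>c. p + sum_list (take (Suc i) as) = q ^ c"
  shows "\<exists>cs. sorted cs \<and> (\<forall>c\<in>set cs. p \<le> q ^ c) \<and> as = power_diffs q p cs"
  using assms
proof (induction as arbitrary: p)
  case Nil
  show ?case by (intro exI[of _ "[]"]) simp
next
  case (Cons x as)
  obtain c where c: "p + x = q ^ c"
    using Cons.prems(2)[rule_format, of 0] by auto
  have "\<forall>i<length as. \<exists>d. q ^ c + sum_list (take (Suc i) as) = q ^ d"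
  proof (intro allI impI)
    fix i assume "i < length as"
    then show "\<exists>d. q ^ c + sum_list (take (Suc i) as) = q ^ d"
      using Cons.prems(2)[rule_format, of "Suc i"] c by (simp add: add.assoc[symmetric])
  qed
  from Cons.IH[OF Cons.prems(1) this] obtain cs where
    cs: "sorted cs" "\<forall>d\<in>set cs. q ^ c \<le> q ^ d" "as = power_diffs q (q ^ c) cs" by blast
  have "\<forall>d\<in>set cs. c \<le> d" using cs(2) Cons.prems(1) by simp
  moreover have "\<forall>d\<in>set cs. p \<le> q ^ d" using cs(2) c by (metis le_add1 le_trans)
  ultimately show ?case using cs c by (intro exI[of _ "c # cs"]) auto
qed

lemma exp_partition_Cons:
  "exp_partition m q (c # cs) = of_digits m (q ^ c # power_diffs q (q ^ c) cs)"
  by (simp add: exp_partition_def)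

text \<open>The digits can be read off the partition, and the exponents are the logarithms of
  the partial sums of the digits.\<close>

lemma inj_on_exp_partition:
  assumes m: "2 \<le> m" and q: "2 \<le> q"
  shows "inj_on (exp_partition m q) exp_lists"
proof (rule inj_onI)
  fix cs ds
  assume cs: "cs \<in> exp_lists" and ds: "ds \<in> exp_lists"
    and eq: "exp_partition m q cs = exp_partition m q ds"
  have dig: "digits m (exp_partition m q es) = power_diffs q 0 es" if es: "es \<in> exp_lists" for es
  proof -
    obtain e es' where "es = e # es'"
      using es by (cases es) (auto simp: exp_lists_def)
    then show ?thesis
      using digits_of_digits[OF m, of "q ^ e" "power_diffs q (q ^ e) es'"] q
      by (simp add: exp_partition_Cons del: of_digits.simps)
  qed
  have pd: "power_diffs q 0 cs = power_diffs q 0 ds"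
    using dig[OF cs] dig[OF ds] eq by simp
  then have len: "length cs = length ds" by (metis length_power_diffs)
  show "cs = ds"
  proof (rule nth_equalityI[OF len])
    fix i assume i: "i < length cs"
    have "q ^ (cs ! i) = q ^ (ds ! i)"
      using sum_list_take_power_diffs[OF q, of cs 0 i] sum_list_take_power_diffs[OF q, of ds 0 i]
        cs ds i len pd by (simp add: exp_lists_def)
    then show "cs ! i = ds ! i" using q by simp
  qed
qed

section \<open>Conjugate \<open>(m, q)\<close>-ary partitions as exponent lists\<close>

lemma ary_iff:
  assumes "2 \<le> m"
  shows "ary m P \<longleftrightarrow> P \<noteq> {#} \<and> (\<forall>p\<in>#P. \<exists>i. p = m ^ i)"
proof -
  have "0 \<notin># P \<and> 0 < sum_mset P" if ne: "P \<noteq> {#}" and pw: "\<forall>p\<in>#P. \<exists>i. p = m ^ i"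
  proof -
    have 0: "0 \<notin># P" using pw assms by force
    obtain p where "p \<in># P" using ne by (rule multiset_nonemptyE)
    with 0 show ?thesis using sum_mset_0_iff[of P] by (metis gr0I)
  qed
  then show ?thesis by (auto simp: ary_def partition_of_def)
qed

lemma filter_replicate_mset:
  "filter_mset Q (replicate_mset n x) = (if Q x then replicate_mset n x else {#})"
  by (induction n) auto

text \<open>Parts are powers of \<open>m\<close>, so a threshold \<open>j\<close> only matters through the
  least \<open>r\<close> with \<open>j \<le> m ^ r\<close>.\<close>

lemma size_filter_of_digits:
  assumes "\<And>i. j \<le> m ^ i \<longleftrightarrow> r \<le> i"
  shows "size {#p \<in># of_digits m as. j \<le> p#} = sum_list (take (length as - r) as)"
proof (induction as)
  case (Cons x as)
  show ?case
  proof (cases "r \<le> length as")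
    case True
    with assms[of "length as"] Cons show ?thesis by (simp add: filter_replicate_mset Suc_diff_le)
  next
    case False
    with assms[of "length as"] Cons show ?thesis by (simp add: filter_replicate_mset)
  qed
qed simp

lemma set_of_digits: "x \<in># of_digits m as \<Longrightarrow> \<exists>i<length as. x = m ^ i"
  by (induction as) (auto split: if_splits intro: less_SucI)

lemma Max_of_digits:
  assumes "2 \<le> m" "x \<noteq> 0"
  shows "Max (set_mset (of_digits m (x # as))) = m ^ length as"
proof (rule Max_eqI)
  fix y assume "y \<in># of_digits m (x # as)"
  then obtain i where "i < length (x # as)" "y = m ^ i" using set_of_digits by blast
  then show "y \<le> m ^ length as" using assms(1) by (simp add: power_increasing)
qed (use assms in auto)

text \<open>The conjugate part at \<open>j\<close> counts the parts that are at least \<open>j\<close>, which is a partial sum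
  of the digits; as \<open>j\<close> runs up to the largest part, every nonempty partial sum occurs, the one
  through the digit of \<open>m ^ r\<close> at \<open>j = m ^ r\<close>.\<close>

lemma conj_ary_of_digits_iff:
  assumes m: "2 \<le> m" and q: "2 \<le> q" and x: "x \<noteq> 0"
  shows "conj_ary m q (of_digits m (x # as)) \<longleftrightarrow>
    (\<forall>i<length (x # as). \<exists>c. sum_list (take (Suc i) (x # as)) = q ^ c)"
    (is "?L \<longleftrightarrow> ?R")
proof -
  let ?P = "of_digits m (x # as)"
  let ?size = "\<lambda>j. size {#p \<in># ?P. j \<le> p#}"
  have "ary m ?P"
    unfolding ary_iff[OF m] using set_of_digits[of _ m "x # as"] x by auto
  moreover have "ary q (conjugate ?P) \<longleftrightarrow> (\<forall>j\<in>{1..m ^ length as}. \<exists>c. ?size j = q ^ c)"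
    using m by (auto simp: ary_iff[OF q] conjugate_def Max_of_digits[OF m x] mset_set_empty_iff
        simp del: of_digits.simps)
  ultimately have "?L \<longleftrightarrow> (\<forall>j\<in>{1..m ^ length as}. \<exists>c. ?size j = q ^ c)"
    by (simp add: conj_ary_def)
  also have "\<dots> \<longleftrightarrow> ?R"
  proof (intro iffI allI ballI impI)
    fix i assume *: "\<forall>j\<in>{1..m ^ length as}. \<exists>c. ?size j = q ^ c" and i: "i < length (x # as)"
    let ?r = "length as - i"
    have "m ^ ?r \<in> {1..m ^ length as}" using m by (auto intro: power_increasing)
    with * obtain c where "?size (m ^ ?r) = q ^ c" by blast
    moreover have "?size (m ^ ?r) = sum_list (take (length (x # as) - ?r) (x # as))"
      by (rule size_filter_of_digits) (use m in simp)
    moreover have "length (x # as) - ?r = Suc i" using i by simp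
    ultimately show "\<exists>c. sum_list (take (Suc i) (x # as)) = q ^ c" by metis
  next
    fix j assume R: ?R and j: "j \<in> {1..m ^ length as}"
    define r where "r = (LEAST r. j \<le> m ^ r)"
    have r: "j \<le> m ^ r" unfolding r_def by (rule LeastI[of _ "length as"]) (use j in simp)
    have rl: "r \<le> length as" unfolding r_def by (rule Least_le) (use j in simp)
    have "j \<le> m ^ i \<longleftrightarrow> r \<le> i" for i
    proof
      show "r \<le> i" if "j \<le> m ^ i" unfolding r_def using that by (rule Least_le)
      show "j \<le> m ^ i" if "r \<le> i"
        using r power_increasing[OF that, of m] m by linarith
    qed
    then have "?size j = sum_list (take (length (x # as) - r) (x # as))"
      by (rule size_filter_of_digits)
    moreover have "length (x # as) - r = Suc (length as - r)" using rl by simp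
    ultimately show "\<exists>c. ?size j = q ^ c" using R[rule_format, of "length as - r"] by simp
  qed
  finally show ?thesis .
qed

lemma conj_ary_eq_exp_partitions:
  assumes m: "2 \<le> m" and q: "2 \<le> q"
  shows "{P. conj_ary m q P} = exp_partition m q ` exp_lists"
proof (intro equalityI subsetI)
  fix P assume "P \<in> {P. conj_ary m q P}"
  then have P: "conj_ary m q P" by simp
  then have ary: "ary m P" by (simp add: conj_ary_def)
  obtain x as where xas: "digits m P = x # as" "x \<noteq> 0" "P = of_digits m (x # as)"
    using of_digits_digits[OF m ary] by (metis list.collapse)
  have "\<forall>i<length (x # as). \<exists>c. 0 + sum_list (take (Suc i) (x # as)) = q ^ c"
    using P conj_ary_of_digits_iff[OF m q xas(2)] unfolding xas(3) add_0 by blast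
  from power_diffs_of_partial_sums[OF q this] obtain cs where
    cs: "sorted cs" "x # as = power_diffs q 0 cs" by blast
  then have "cs \<in> exp_lists" by (auto simp: exp_lists_def)
  then show "P \<in> exp_partition m q ` exp_lists"
    unfolding xas(3) cs(2) exp_partition_def by blast
next
  fix P assume "P \<in> exp_partition m q ` exp_lists"
  then obtain cs where cs: "P = exp_partition m q cs" "sorted cs" "cs \<noteq> []"
    by (auto simp: exp_lists_def)
  then obtain c cs' where c: "cs = c # cs'" by (cases cs) auto
  have "\<exists>d. sum_list (take (Suc i) (power_diffs q 0 cs)) = q ^ d" if "i < length cs" for i
    using sum_list_take_power_diffs[OF q cs(2), of 0 i] that by auto
  then show "P \<in> {P. conj_ary m q P}"
    using conj_ary_of_digits_iff[OF m q, of "q ^ c" "power_diffs q (q ^ c) cs'"] q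
    by (simp add: cs(1) c exp_partition_Cons del: of_digits.simps)
qed

section \<open>Words in the operators\<close>

lemma map_mult_power_diffs:
  "map (\<lambda>x. q * x) (power_diffs q p cs) = power_diffs q (q * p) (map Suc cs)"
  by (induction cs arbitrary: p) (simp_all add: diff_mult_distrib2)

lemma raise_exp_partition:
  assumes "2 \<le> m" "2 \<le> q" "cs \<noteq> []"
  shows "raise m q (exp_partition m q cs) = exp_partition m q (map Suc cs)"
proof -
  obtain c cs' where "cs = c # cs'" using assms(3) by (cases cs) auto
  then show ?thesis
    using raise_of_digits[OF assms(1), of "q ^ c" q "power_diffs q (q ^ c) cs'"] assms(2)
    by (simp add: exp_partition_Cons map_mult_power_diffs del: of_digits.simps)
qed

lemma migration_exp_partition:
  assumes "2 \<le> m" "2 \<le> q" "cs \<noteq> []"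
  shows "migration m (exp_partition m q cs) = exp_partition m q (0 # cs)"
proof -
  obtain c cs' where "cs = c # cs'" using assms(3) by (cases cs) auto
  then show ?thesis
    using migration_of_digits[OF assms(1), of "q ^ c" "power_diffs q (q ^ c) cs'"] assms(2)
    by (simp add: exp_partition_Cons del: of_digits.simps)
qed

text \<open>The exponent list of the partition that a word produces.\<close>

fun exponents :: "(nat \<times> nat) list \<Rightarrow> nat list" where
  "exponents [] = [0]"
| "exponents ((s, t) # w) = replicate s 0 @ map ((+) t) (exponents w)"

lemma exponents_nonempty: "exponents w \<noteq> []"
  by (induction w rule: exponents.induct) auto

lemma exponents_in_exp_lists: "exponents w \<in> exp_lists"
proof -
  have "sorted (exponents w)"
  proof (induction w rule: exponents.induct)
    case (2 s t w)
    then have "sorted (map ((+) t) (exponents w))" by (simp add: sorted_map)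
    then show ?case by (simp add: sorted_append)
  qed simp
  then show ?thesis by (simp add: exp_lists_def exponents_nonempty)
qed

lemma MR_word_eq_exp_partition:
  assumes m: "2 \<le> m" and q: "2 \<le> q"
  shows "MR_word m q w = exp_partition m q (exponents w)"
proof (induction w rule: exponents.induct)
  case 1
  show ?case by (simp add: exp_partition_def)
next
  case (2 s t w)
  have R: "(raise m q ^^ t) (exp_partition m q (exponents w))
      = exp_partition m q (map ((+) t) (exponents w))" for t
  proof (induction t)
    case 0
    show ?case by (simp add: map_idI)
  next
    case (Suc t)
    then show ?case
      by (simp add: raise_exp_partition[OF m q] exponents_nonempty comp_def)
  qed
  have M: "(migration m ^^ s) (exp_partition m q (map ((+) t) (exponents w)))
      = exp_partition m q (replicate s 0 @ map ((+) t) (exponents w))" for s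
    by (induction s) (simp_all add: migration_exp_partition[OF m q] exponents_nonempty)
  show ?case using 2 R M by simp
qed

text \<open>Subtract the smallest exponent \<open>c\<close>, which corresponds to undoing \<open>c\<close> raises; the list then
  starts with 0, which corresponds to undoing one migration.\<close>

lemma sorted_is_exponents:
  assumes "cs \<in> exp_lists"
  shows "\<exists>w. w \<noteq> [] \<and> exponents w = cs"
  using assms
proof (induction "length cs" arbitrary: cs rule: less_induct)
  case less
  then obtain c cs' where cs: "cs = c # cs'" by (cases cs) (auto simp: exp_lists_def)
  show ?case
  proof (cases "cs' = []")
    case True
    with cs show ?thesis by (intro exI[of _ "[(0, c)]"]) simp
  next
    case False
    have c: "\<forall>d\<in>set cs'. c \<le> d" and sorted: "sorted cs'"
      using less.prems by (auto simp: cs exp_lists_def)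
    let ?ds = "map (\<lambda>d. d - c) cs'"
    have "sorted ?ds" using sorted by (auto simp: sorted_iff_nth_mono intro: diff_le_mono)
    with False have "?ds \<in> exp_lists" by (simp add: exp_lists_def)
    with less.hyps[of ?ds] obtain w where "exponents w = ?ds" by (auto simp: cs)
    then have "exponents ((0, c) # (1, 0) # w) = cs"
      using c by (auto simp: cs intro!: map_idI)
    then show ?thesis by blast
  qed
qed

section \<open>Scaling a word\<close>

fun scale_exponents :: "nat \<Rightarrow> nat \<Rightarrow> nat list \<Rightarrow> nat list" where
  "scale_exponents a b [] = []"
| "scale_exponents a b [c] = [b * c]"
| "scale_exponents a b (c # d # cs) = replicate a (b * c) @ scale_exponents a b (d # cs)"

abbreviation scale_word :: "nat \<Rightarrow> nat \<Rightarrow> (nat \<times> nat) list \<Rightarrow> (nat \<times> nat) list" where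
  "scale_word a b \<equiv> map (\<lambda>(s, t). (a * s, b * t))"

lemma scale_exponents_Cons:
  "cs \<noteq> [] \<Longrightarrow> scale_exponents a b (c # cs) = replicate a (b * c) @ scale_exponents a b cs"
  by (cases cs) auto

lemma scale_exponents_replicate_append:
  "cs \<noteq> [] \<Longrightarrow>
    scale_exponents a b (replicate s c @ cs) = replicate (a * s) (b * c) @ scale_exponents a b cs"
  by (induction s) (simp_all add: scale_exponents_Cons replicate_add)

lemma scale_exponents_map_add:
  "scale_exponents a b (map ((+) t) cs) = map ((+) (b * t)) (scale_exponents a b cs)"
  by (induction a b cs rule: scale_exponents.induct) (simp_all add: add_mult_distrib2)

lemma exponents_scaled_word:
  "exponents (scale_word a b w) = scale_exponents a b (exponents w)"
  by (induction w rule: exponents.induct)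
    (simp_all add: scale_exponents_replicate_append scale_exponents_map_add exponents_nonempty)

lemma length_scale_exponents:
  "cs \<noteq> [] \<Longrightarrow> length (scale_exponents a b cs) = Suc (a * (length cs - 1))"
  by (induction a b cs rule: scale_exponents.induct) auto

text \<open>The length of the image determines the length of the list. Lists of equal length are then
  cut into blocks at the same places, and a block of \<open>a > 0\<close> copies of \<open>b * c\<close>
  determines \<open>c\<close>.\<close>

lemma inj_on_scale_exponents:
  assumes "0 < a" "0 < b"
  shows "inj_on (scale_exponents a b) exp_lists"
proof -
  have "cs = ds" if "length cs = length ds" "scale_exponents a b cs = scale_exponents a b ds"
    for cs ds
    using that
  proof (induction cs ds rule: list_induct2)
    case (Cons c cs d ds)
    show ?case
    proof (cases "cs = []")
      case True
      with Cons assms show ?thesis by simp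
    next
      case False
      with Cons.hyps have "ds \<noteq> []" by auto
      with False Cons assms show ?thesis by (simp add: scale_exponents_Cons)
    qed
  qed simp
  moreover have "length cs = length ds"
    if "cs \<in> exp_lists" "ds \<in> exp_lists" "scale_exponents a b cs = scale_exponents a b ds" for cs ds
  proof -
    have ne: "cs \<noteq> []" "ds \<noteq> []" using that by (auto simp: exp_lists_def)
    then have "length cs - 1 = length ds - 1"
      using length_scale_exponents[of cs a b] length_scale_exponents[of ds a b] that(3) assms
      by simp
    with ne show ?thesis by (cases cs; cases ds) auto
  qed
  ultimately show ?thesis by (meson inj_onI)
qed

lemma scale_exponents_image:
  "scale_exponents a b ` exp_lists = {exponents (scale_word a b w) | w. w \<noteq> []}"
  using sorted_is_exponents exponents_in_exp_lists
  by (fastforce simp: exponents_scaled_word image_iff)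

theorem proposition6p2:
  fixes m q a b :: nat
  assumes "2 \<le> m" and "2 \<le> q" and "0 < a" and "0 < b"
  shows "\<exists>f :: nat multiset \<Rightarrow> nat multiset.
    bij_betw f
      {P. conj_ary (m ^ a) (q ^ b) P}
      {P. conj_ary m q P \<and>
          (\<exists>w. w \<noteq> [] \<and> P = MR_word m q (map (\<lambda>(s, t). (a * s, b * t)) w))}
    \<and> (\<forall>w. w \<noteq> [] \<longrightarrow>
          f (MR_word (m ^ a) (q ^ b) w) = MR_word m q (map (\<lambda>(s, t). (a * s, b * t)) w))"
proof -
  have big: "2 \<le> m ^ a" "2 \<le> q ^ b"
    using assms self_le_power[of m a] self_le_power[of q b] by linarith+
  let ?code = "exp_partition (m ^ a) (q ^ b)"
  let ?scale = "\<lambda>cs. exp_partition m q (scale_exponents a b cs)"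
  let ?decode = "the_inv_into exp_lists ?code"
  let ?f = "\<lambda>P. ?scale (?decode P)"
  let ?B = "{P. conj_ary m q P \<and> (\<exists>w. w \<noteq> [] \<and> P = MR_word m q (scale_word a b w))}"
  have code: "inj_on ?code exp_lists" by (rule inj_on_exp_partition[OF big])
  have B: "?B = ?scale ` exp_lists"
  proof -
    have "conj_ary m q (MR_word m q w)" for w
      using conj_ary_eq_exp_partitions[OF assms(1,2)] exponents_in_exp_lists[of w]
      by (auto simp: MR_word_eq_exp_partition[OF assms(1,2)])
    then have "?B = exp_partition m q ` {exponents (scale_word a b w) | w. w \<noteq> []}"
      by (auto simp: MR_word_eq_exp_partition[OF assms(1,2)])
    then show ?thesis by (simp only: scale_exponents_image[symmetric] image_image)
  qed
  have "scale_exponents a b ` exp_lists \<subseteq> exp_lists"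
    using exponents_in_exp_lists by (auto simp: scale_exponents_image)
  then have "inj_on (exp_partition m q \<circ> scale_exponents a b) exp_lists"
    using inj_on_scale_exponents[OF assms(3,4)] inj_on_exp_partition[OF assms(1,2)]
    by (intro comp_inj_on) (auto intro: inj_on_subset)
  then have "bij_betw ?scale exp_lists ?B"
    unfolding B bij_betw_def comp_def by blast
  moreover have "bij_betw ?decode {P. conj_ary (m ^ a) (q ^ b) P} exp_lists"
    by (rule bij_betw_the_inv_into)
      (use code conj_ary_eq_exp_partitions[OF big] in \<open>simp add: bij_betw_def\<close>)
  ultimately have "bij_betw ?f {P. conj_ary (m ^ a) (q ^ b) P} ?B"
    using bij_betw_trans[of ?decode _ exp_lists ?scale ?B] by (simp add: comp_def)
  moreover have "?f (MR_word (m ^ a) (q ^ b) w) = MR_word m q (scale_word a b w)" for w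
    using the_inv_into_f_f[OF code exponents_in_exp_lists]
    by (simp add: MR_word_eq_exp_partition[OF big] MR_word_eq_exp_partition[OF assms(1,2)]
        exponents_scaled_word)
  ultimately show ?thesis by blast
qed

end
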